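(* Let $M$ be Hrushovski's countable non-collapsed structure for a (not necessarily symmetric) ternary relation $R$ all of whose tuples consist of distinct elements, and let $M_\sim=(M;R_\sim)$ be its reduct to the symmetrization $R_\sim(x_1,x_2,x_3):=\bigvee_{\sigma\in S_3}R(x_{\sigma(1)},x_{\sigma(2)},x_{\sigma(3)})$. Let $\mathfrak{C}_\sim$ be the category whose objects are the finite $R_\sim$-structures $A$ with $\emptyset\leqslant_\sim A$ and whose morphisms are the $\sim$-strong embeddings. Then $M_\sim$ is the Fraïssé limit of $\mathfrak{C}_\sim$.
   Context: The structure $M$. Structures are sets with a ternary relation $R$ holding only of triples of pairwise distinct elements. For finite $A$, $d_0(A)=|A|-|R_A|$ where $R_A\subseteq A^3$ is the set of ordered triples in the relation. For finite $A\subseteq N$, $A\leqslant N$ means $d_0(B)\ge d_0(A)$ for all finite $B$ with $A\subseteq B\subseteq N$. $\mathcal{C}$ is the class of finite structures $A$ with $\emptyset\leqslant A$. $M$ is the unique (up to isomorphism) countable structure all of whose finite substructures lie in $\mathcal{C}$ and such that whenever $A\leqslant M$ is finite and $A\leqslant B\in\mathcal{C}$ there is an embedding of $B$ into $M$ over $A$ with strong image. $R_\sim$-structures. An $R_\sim$-structure is a set with a symmetric ternary relation $R_\sim$ holding only of triples of pairwise distinct elements. For a finite $R_\sim$-structure $A$, $d_0^\sim(A)=|A|-r_\sim(A)$ where $r_\sim(A)$ is the number of three-element subsets $\{a,b,c\}\subseteq A$ with $R_\sim(a,b,c)$. For $A\subseteq N$ finite, $d^\sim(A,N)=\min\{d_0^\sim(B):A\subseteq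 B\subseteq N,\ B\text{ finite}\}$ and $A\leqslant_\sim N$ ("$\sim$-strong") means $d^\sim(A,N)=d_0^\sim(A)$. An embedding is $\sim$-strong if its image is $\sim$-strong in the target. Fraïssé limit of $\mathfrak{C}_\sim$: the unique (up to isomorphism) countable $R_\sim$-structure whose finite substructures are, up to isomorphism, exactly the objects of $\mathfrak{C}_\sim$, into which every object of $\mathfrak{C}_\sim$ $\sim$-strongly embeds, and in which every isomorphism between finite $\sim$-strong substructures extends to an automorphism. (It is Hrushovski's non-collapsed construction for a symmetric ternary relation.) *)

theory Defs
  imports Complex_Main "HOL-Library.Countable_Set"
begin

record 'a ternary =
  carr :: "'a set"
  rel :: "'a \<Rightarrow> 'a \<Rightarrow> 'a \<Rightarrow> bool"

definition R_structure :: "'a ternary \<Rightarrow> bool" where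
  "R_structure N \<longleftrightarrow>
    (\<forall>x y z. rel N x y z \<longrightarrow>
      x \<in> carr N \<and> y \<in> carr N \<and> z \<in> carr N \<and> x \<noteq> y \<and> x \<noteq> z \<and> y \<noteq> z)"

definition induced :: "'a ternary \<Rightarrow> 'a set \<Rightarrow> 'a ternary" where
  "induced N A =
    \<lparr>carr = A, rel = (\<lambda>x y z. x \<in> A \<and> y \<in> A \<and> z \<in> A \<and> rel N x y z)\<rparr>"

definition embedding :: "('a \<Rightarrow> 'b) \<Rightarrow> 'a ternary \<Rightarrow> 'b ternary \<Rightarrow> bool" where
  "embedding f A N \<longleftrightarrow>
    inj_on f (carr A) \<and> f ` carr A \<subseteq> carr N \<and>
    (\<forall>x\<in>carr A. \<forall>y\<in>carr A. \<forall>z\<in>carr A. rel A x y z \<longleftrightarrow> rel N (f x) (f y) (f z))"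

definition isomorphism :: "('a \<Rightarrow> 'b) \<Rightarrow> 'a ternary \<Rightarrow> 'b ternary \<Rightarrow> bool" where
  "isomorphism f A B \<longleftrightarrow> embedding f A B \<and> f ` carr A = carr B"


definition d0 :: "'a ternary \<Rightarrow> int" where
  "d0 A = int (card (carr A)) - int (card {(x, y, z). rel A x y z})"

definition strong :: "'a set \<Rightarrow> 'a ternary \<Rightarrow> bool" where
  "strong A N \<longleftrightarrow>
    finite A \<and> A \<subseteq> carr N \<and>
    (\<forall>B. finite B \<and> A \<subseteq> B \<and> B \<subseteq> carr N \<longrightarrow> d0 (induced N B) \<ge> d0 (induced N A))"

definition in_C :: "'a ternary \<Rightarrow> bool" where
  "in_C A \<longleftrightarrow> R_structure A \<and> finite (carr A) \<and> strong {} A"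

text \<open>
  The abstract finite structure \<open>B\<close> ranges over structures on sets of natural numbers, and
  \<open>A \<le> B\<close> is a strong embedding \<open>e\<close> of \<open>A\<close> into \<open>B\<close>. Every finite structure has an isomorphic
  copy there, whereas quantifying over structures on the type \<open>'a\<close> of the elements of \<open>M\<close> would
  lose generality if \<open>'a\<close> were finite.
\<close>
definition hrushovski_structure :: "'a ternary \<Rightarrow> bool" where
  "hrushovski_structure M \<longleftrightarrow>
    R_structure M \<and> countable (carr M) \<and>
    (\<forall>A. finite A \<and> A \<subseteq> carr M \<longrightarrow> in_C (induced M A)) \<and>
    (\<forall>A (B :: nat ternary) e.
      strong A M \<and> in_C B \<and> embedding e (induced M A) B \<and> strong (e ` A) B \<longrightarrow>
      (\<exists>g. embedding g B M \<and> strong (g ` carr B) M \<and> (\<forall>a\<in>A. g (e a) = a)))"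


definition symmetrization :: "'a ternary \<Rightarrow> 'a ternary" where
  "symmetrization N =
    \<lparr>carr = carr N,
     rel = (\<lambda>x y z. rel N x y z \<or> rel N x z y \<or> rel N y x z \<or>
                    rel N y z x \<or> rel N z x y \<or> rel N z y x)\<rparr>"

definition Rsim_structure :: "'a ternary \<Rightarrow> bool" where
  "Rsim_structure N \<longleftrightarrow>
    R_structure N \<and>
    (\<forall>x y z. rel N x y z \<longrightarrow> rel N y x z \<and> rel N x z y)"

definition r_sim :: "'a ternary \<Rightarrow> nat" where
  "r_sim A = card {S. S \<subseteq> carr A \<and> card S = 3 \<and> (\<exists>a b c. S = {a, b, c} \<and> rel A a b c)}"

definition d0_sim :: "'a ternary \<Rightarrow> int" where
  "d0_sim A = int (card (carr A)) - int (r_sim A)"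

definition d0_sim_values :: "'a set \<Rightarrow> 'a ternary \<Rightarrow> int set" where
  "d0_sim_values A N = {d0_sim (induced N B) | B. finite B \<and> A \<subseteq> B \<and> B \<subseteq> carr N}"

definition d_sim :: "'a set \<Rightarrow> 'a ternary \<Rightarrow> int" where
  "d_sim A N = Inf (d0_sim_values A N)"

text \<open>
  For infinite \<open>N\<close> the minimum defining \<open>d_sim A N\<close> need not exist, in which case the infimum in
  \<^typ>\<open>int\<close> is an unspecified integer. Such an \<open>A\<close> is not \<open>\<sim>\<close>-strong in \<open>N\<close>, hence the
  boundedness condition.
\<close>
definition sim_strong :: "'a set \<Rightarrow> 'a ternary \<Rightarrow> bool" where
  "sim_strong A N \<longleftrightarrow>
    finite A \<and> A \<subseteq> carr N \<and> bdd_below (d0_sim_values A N) \<and>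
    d_sim A N = d0_sim (induced N A)"

lemma sim_strong_iff:
  "sim_strong A N \<longleftrightarrow>
    finite A \<and> A \<subseteq> carr N \<and>
    (\<forall>B. finite B \<and> A \<subseteq> B \<and> B \<subseteq> carr N \<longrightarrow> d0_sim (induced N B) \<ge> d0_sim (induced N A))"
proof (cases "finite A \<and> A \<subseteq> carr N")
  case True
  then have mem: "d0_sim (induced N A) \<in> d0_sim_values A N"
    by (auto simp: d0_sim_values_def)
  have "bdd_below (d0_sim_values A N) \<and> Inf (d0_sim_values A N) = d0_sim (induced N A) \<longleftrightarrow>
      (\<forall>v\<in>d0_sim_values A N. d0_sim (induced N A) \<le> v)"
  proof
    assume "bdd_below (d0_sim_values A N) \<and> Inf (d0_sim_values A N) = d0_sim (induced N A)"
    then show "\<forall>v\<in>d0_sim_values A N. d0_sim (induced N A) \<le> v"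
      using cInf_lower by metis
  next
    assume "\<forall>v\<in>d0_sim_values A N. d0_sim (induced N A) \<le> v"
    then show "bdd_below (d0_sim_values A N) \<and>
        Inf (d0_sim_values A N) = d0_sim (induced N A)"
      using mem by (auto intro: cInf_eq_minimum bdd_belowI)
  qed
  then show ?thesis
    using True unfolding sim_strong_def d_sim_def by (auto simp: d0_sim_values_def)
qed (auto simp: sim_strong_def)

definition sim_strong_embedding :: "('a \<Rightarrow> 'b) \<Rightarrow> 'a ternary \<Rightarrow> 'b ternary \<Rightarrow> bool" where
  "sim_strong_embedding f A N \<longleftrightarrow> embedding f A N \<and> sim_strong (f ` carr A) N"

definition in_C_sim :: "'a ternary \<Rightarrow> bool" where
  "in_C_sim A \<longleftrightarrow> Rsim_structure A \<and> finite (carr A) \<and> sim_strong {} A"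

text \<open>
  As above, structures on sets of natural numbers represent all isomorphism types of objects of
  the category.
\<close>
definition fraisse_limit_C_sim :: "'a ternary \<Rightarrow> bool" where
  "fraisse_limit_C_sim N \<longleftrightarrow>
    Rsim_structure N \<and> countable (carr N) \<and>
    (\<forall>A. finite A \<and> A \<subseteq> carr N \<longrightarrow> in_C_sim (induced N A)) \<and>
    (\<forall>B :: nat ternary. in_C_sim B \<longrightarrow>
      (\<exists>A f. finite A \<and> A \<subseteq> carr N \<and> isomorphism f B (induced N A))) \<and>
    (\<forall>B :: nat ternary. in_C_sim B \<longrightarrow> (\<exists>f. sim_strong_embedding f B N)) \<and>
    (\<forall>A B f. sim_strong A N \<and> sim_strong B N \<and> isomorphism f (induced N A) (induced N B) \<longrightarrow>
      (\<exists>g. isomorphism g N N \<and> (\<forall>a\<in>A. g a = f a)))"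

end

theory Submission
  imports Defs
begin

text \<open>
  Write \<open>\<delta>\<^sub>R X\<close> for the number of points minus the number of ordered tuples in \<open>X\<close>, and \<open>\<delta>\<^sub>E X\<close> for
  the number of points minus the number of three-element sets that carry a tuple. Strong sets are
  those whose \<open>\<delta>\<^sub>R\<close> does not drop under finite extensions, and \<open>\<sim>\<close>-strong sets are the same for
  \<open>\<delta>\<^sub>E\<close>. Extending a set adds at least as many tuples as edges, so a strong set is \<open>\<sim>\<close>-strong
  (\<open>strong_imp_sim_strong_symmetrization\<close>). The converse fails: if \<open>R(a,b,c)\<close> and \<open>R(b,a,c)\<close> are the
  only tuples, then \<open>{a,b}\<close> is \<open>\<sim>\<close>-strong but not strong. The genericity of \<open>M\<close>, which speaks about
  strong sets only, therefore does not apply directly to a \<open>\<sim>\<close>-strong set \<open>B\<close>.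

  The remedy is the extension lemma \<open>hrushovski_sim_extension\<close>. Let \<open>B\<close> be \<open>\<sim>\<close>-strong in the reduct
  and \<open>\<sim>\<close>-strong in a finite symmetric structure \<open>C\<close> whose empty subset is \<open>\<sim>\<close>-strong. Enlarge \<open>B\<close>
  to a finite strong \<open>A\<close> in \<open>M\<close>, form the free amalgam of \<open>A\<close> and \<open>C\<close> over \<open>B\<close>, keep the given
  tuples on \<open>A\<close>, and put exactly one tuple on every other edge. Over \<open>A\<close> the two predimensions then grow at the same rate, and \<open>\<delta>\<^sub>E\<close> does not drop because
  \<open>B\<close> is \<open>\<sim>\<close>-strong in \<open>C\<close>; so \<open>A\<close> is strong in the amalgam, which lies in the class of \<open>M\<close> and
  embeds strongly into \<open>M\<close> over \<open>A\<close>. Its image is \<open>\<sim>\<close>-strong in the reduct, and \<open>C\<close> is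
  \<open>\<sim>\<close>-strong in the amalgam because \<open>B\<close> is \<open>\<sim>\<close>-strong in \<open>A\<close>. By transitivity the image of \<open>C\<close> is
  \<open>\<sim>\<close>-strong in the reduct.

  Applied over the empty set, the extension lemma gives universality. Homogeneity follows from it by
  back-and-forth, since every finite set of points lies in a finite \<open>\<sim>\<close>-strong one
  (\<open>sim_partial_iso_forth\<close>, \<open>back_and_forth\<close>).
\<close>

section \<open>Predimensions\<close>

text \<open>
  Tuples and unordered edges differ only in how a relation instance determines its set of points.
  The support function \<open>supp\<close> abstracts from this, so that both predimensions are instances.
\<close>
definition predim :: "('t \<Rightarrow> 'v set) \<Rightarrow> 't set \<Rightarrow> 'v set \<Rightarrow> int" where
  "predim supp E X = int (card X) - int (card {t \<in> E. supp t \<subseteq> X})"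

definition locally_finite :: "('t \<Rightarrow> 'v set) \<Rightarrow> 't set \<Rightarrow> bool" where
  "locally_finite supp E \<longleftrightarrow> (\<forall>X. finite X \<longrightarrow> finite {t \<in> E. supp t \<subseteq> X})"

lemma predim_empty:
  assumes "\<And>t. t \<in> E \<Longrightarrow> supp t \<noteq> {}"
  shows "predim supp E {} = 0"
proof -
  have "{t \<in> E. supp t \<subseteq> {}} = {}"
    using assms by auto
  then show ?thesis
    by (simp only: predim_def) simp
qed

lemma predim_diff:
  assumes lf: "locally_finite supp E" and X: "finite X" and AX: "A \<subseteq> X"
  shows "predim supp E X - predim supp E A =
    int (card (X - A)) - int (card {t \<in> E. supp t \<subseteq> X \<and> \<not> supp t \<subseteq> A})"
proof -
  have fA: "finite A"
    using X AX finite_subset by blast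
  have fE: "finite {t \<in> E. supp t \<subseteq> X}"
    using lf X by (simp add: locally_finite_def)
  have split: "{t \<in> E. supp t \<subseteq> X} =
      {t \<in> E. supp t \<subseteq> A} \<union> {t \<in> E. supp t \<subseteq> X \<and> \<not> supp t \<subseteq> A}"
    using AX by blast
  have "card {t \<in> E. supp t \<subseteq> X} =
      card {t \<in> E. supp t \<subseteq> A} + card {t \<in> E. supp t \<subseteq> X \<and> \<not> supp t \<subseteq> A}"
    unfolding split using AX by (intro card_Un_disjoint finite_subset[OF _ fE]) auto
  moreover have "card X = card A + card (X - A)"
    using card_Diff_subset[OF fA AX] card_mono[OF X AX] by simp
  ultimately show ?thesis
    by (simp add: predim_def)
qed

text \<open>
  The instances over \<open>P\<close> and those over \<open>Q\<close> are all instances over \<open>P \<union> Q\<close>, and those counted twice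
  are exactly the ones over \<open>P \<inter> Q\<close>. Only instances that cross between \<open>P - Q\<close> and \<open>Q - P\<close> can make
  the inequality strict.
\<close>
lemma predim_submodular:
  assumes lf: "locally_finite supp E" and P: "finite P" and Q: "finite Q"
  shows "predim supp E (P \<union> Q) + predim supp E (P \<inter> Q) \<le> predim supp E P + predim supp E Q"
proof -
  let ?over = "\<lambda>X. {t \<in> E. supp t \<subseteq> X}"
  have fin: "finite (?over P)" "finite (?over Q)" "finite (?over (P \<union> Q))"
    using lf P Q by (simp_all add: locally_finite_def)
  have "?over (P \<inter> Q) = ?over P \<inter> ?over Q"
    by auto
  then have "card (?over P) + card (?over Q) = card (?over P \<union> ?over Q) + card (?over (P \<inter> Q))"
    using card_Un_Int[OF fin(1,2)] by simp
  moreover have "card (?over P \<union> ?over Q) \<le> card (?over (P \<union> Q))"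
    by (rule card_mono[OF fin(3)]) auto
  ultimately show ?thesis
    using card_Un_Int[OF P Q] by (simp add: predim_def)
qed

lemma predim_free_amalgam:
  assumes lf: "locally_finite supp E" and P: "finite P" and Q: "finite Q"
    and free: "\<And>t. t \<in> E \<Longrightarrow> supp t \<subseteq> P \<union> Q \<Longrightarrow> supp t \<subseteq> P \<or> supp t \<subseteq> Q"
  shows "predim supp E (P \<union> Q) + predim supp E (P \<inter> Q) = predim supp E P + predim supp E Q"
proof -
  let ?over = "\<lambda>X. {t \<in> E. supp t \<subseteq> X}"
  have fin: "finite (?over P)" "finite (?over Q)"
    using lf P Q by (simp_all add: locally_finite_def)
  have "?over (P \<inter> Q) = ?over P \<inter> ?over Q" "?over (P \<union> Q) = ?over P \<union> ?over Q"
    using free by auto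
  then have "card (?over P) + card (?over Q) = card (?over (P \<union> Q)) + card (?over (P \<inter> Q))"
    using card_Un_Int[OF fin] by simp
  then show ?thesis
    using card_Un_Int[OF P Q] by (simp add: predim_def)
qed

text \<open>
  In a free amalgam the relative predimension of \<open>X\<close> over \<open>P\<close> is that of \<open>X \<inter> Q\<close> over \<open>P \<inter> Q\<close>, so
  self-sufficiency of the common part in \<open>Q\<close> passes to \<open>P\<close> in the amalgam.
\<close>

lemma free_amalgam_self_sufficient:
  assumes lf: "locally_finite supp E" and P: "finite P" and Q: "finite Q"
    and free: "\<And>t. t \<in> E \<Longrightarrow> supp t \<subseteq> P \<or> supp t \<subseteq> Q"
    and strong: "\<And>Y. P \<inter> Q \<subseteq> Y \<Longrightarrow> Y \<subseteq> Q \<Longrightarrow> predim supp E (P \<inter> Q) \<le> predim supp E Y"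
    and X: "P \<subseteq> X" "X \<subseteq> P \<union> Q"
  shows "predim supp E P \<le> predim supp E X"
proof -
  have eq: "P \<union> X \<inter> Q = X" "P \<inter> (X \<inter> Q) = P \<inter> Q"
    using X by blast+
  have "supp t \<subseteq> P \<or> supp t \<subseteq> X \<inter> Q" if "t \<in> E" "supp t \<subseteq> P \<union> X \<inter> Q" for t
    using free[OF that(1)] that(2) eq(1) by auto
  then have "predim supp E X + predim supp E (P \<inter> Q) = predim supp E P + predim supp E (X \<inter> Q)"
    using predim_free_amalgam[OF lf P, of "X \<inter> Q"] Q unfolding eq by simp
  moreover have "predim supp E (P \<inter> Q) \<le> predim supp E (X \<inter> Q)"
    using X(1) by (intro strong) auto
  ultimately show ?thesis
    by linarith
qed

text \<open>
  Intersecting with a self-sufficient set does not increase the predimension: by submodularity,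
  \<open>X\<close> has over \<open>X \<inter> A\<close> at least the relative predimension that \<open>X \<union> A\<close> has over \<open>A\<close>. This gives
  transitivity of strongness, and it reduces nonnegativity on \<open>V\<close> to subsets of \<open>A\<close>.
\<close>
lemma predim_Int_le:
  assumes lf: "locally_finite supp E" and A: "finite A" "A \<subseteq> V"
    and strong: "\<And>X. finite X \<Longrightarrow> A \<subseteq> X \<Longrightarrow> X \<subseteq> V \<Longrightarrow> predim supp E A \<le> predim supp E X"
    and X: "finite X" "X \<subseteq> V"
  shows "predim supp E (X \<inter> A) \<le> predim supp E X"
proof -
  have "predim supp E (X \<union> A) + predim supp E (X \<inter> A) \<le> predim supp E X + predim supp E A"
    by (rule predim_submodular[OF lf X(1) A(1)])
  moreover have "predim supp E A \<le> predim supp E (X \<union> A)"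
    using A X by (intro strong) auto
  ultimately show ?thesis
    by linarith
qed

text \<open>
  Nonnegative integer values have a minimum. For the two predimensions a minimizer is a strong or
  \<open>\<sim>\<close>-strong set around \<open>A\<close>.
\<close>
lemma self_sufficient_closure:
  fixes \<delta> :: "'v set \<Rightarrow> int"
  assumes A: "finite A" "A \<subseteq> V"
    and nonneg: "\<And>X. finite X \<Longrightarrow> X \<subseteq> V \<Longrightarrow> 0 \<le> \<delta> X"
  shows "\<exists>A'. finite A' \<and> A \<subseteq> A' \<and> A' \<subseteq> V \<and>
    (\<forall>X. finite X \<and> A' \<subseteq> X \<and> X \<subseteq> V \<longrightarrow> \<delta> A' \<le> \<delta> X)"
proof -
  let ?P = "\<lambda>X. finite X \<and> A \<subseteq> X \<and> X \<subseteq> V"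
  have "?P A"
    using A by simp
  then obtain A' where A': "?P A'" "\<And>X. ?P X \<Longrightarrow> nat (\<delta> A') \<le> nat (\<delta> X)"
    using ex_has_least_nat[of ?P A "\<lambda>X. nat (\<delta> X)"] by blast
  have "\<delta> A' \<le> \<delta> X" if "finite X" "A' \<subseteq> X" "X \<subseteq> V" for X
    using A'(2)[of X] A'(1) that nonneg[of X] by force
  then show ?thesis
    using A'(1) by blast
qed

section \<open>The two predimensions of a ternary structure\<close>

definition tuples :: "'a ternary \<Rightarrow> ('a \<times> 'a \<times> 'a) set" where
  "tuples N = {(x, y, z). rel N x y z}"

fun tset :: "'a \<times> 'a \<times> 'a \<Rightarrow> 'a set" where
  "tset (x, y, z) = {x, y, z}"

definition edges :: "'a ternary \<Rightarrow> 'a set set" where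
  "edges N = {S. card S = 3 \<and> (\<exists>a b c. S = {a, b, c} \<and> rel N a b c)}"

abbreviation \<delta>\<^sub>R :: "'a ternary \<Rightarrow> 'a set \<Rightarrow> int" where
  "\<delta>\<^sub>R N \<equiv> predim tset (tuples N)"

abbreviation \<delta>\<^sub>E :: "'a ternary \<Rightarrow> 'a set \<Rightarrow> int" where
  "\<delta>\<^sub>E N \<equiv> predim (\<lambda>S. S) (edges N)"

lemma d0_induced: "d0 (induced N X) = \<delta>\<^sub>R N X"
proof -
  have "{(x, y, z). rel (induced N X) x y z} = {t \<in> tuples N. tset t \<subseteq> X}"
    by (auto simp: induced_def tuples_def)
  then show ?thesis
    by (simp add: d0_def predim_def) (simp add: induced_def)
qed

lemma d0_sim_induced: "d0_sim (induced N X) = \<delta>\<^sub>E N X"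
proof -
  have "{S. S \<subseteq> carr (induced N X) \<and> card S = 3 \<and>
      (\<exists>a b c. S = {a, b, c} \<and> rel (induced N X) a b c)} = {S \<in> edges N. S \<subseteq> X}"
    by (auto simp: induced_def edges_def)
  then show ?thesis
    by (simp add: d0_sim_def r_sim_def predim_def) (simp add: induced_def)
qed

lemma locally_finite_tuples: "locally_finite tset (tuples N)"
  unfolding locally_finite_def
proof (intro allI impI)
  fix X :: "'a set"
  assume "finite X"
  then have "finite (X \<times> X \<times> X)"
    by simp
  then show "finite {t \<in> tuples N. tset t \<subseteq> X}"
    by (rule rev_finite_subset) auto
qed

lemma locally_finite_edges: "locally_finite (\<lambda>S. S) (edges N)"
  unfolding locally_finite_def
proof (intro allI impI)
  fix X :: "'a set"
  assume "finite X"
  then have "finite (Pow X)"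
    by simp
  then show "finite {S \<in> edges N. S \<subseteq> X}"
    by (rule rev_finite_subset) auto
qed

lemma edges_eq_tset_tuples:
  assumes "R_structure N"
  shows "edges N = tset ` tuples N"
proof
  show "edges N \<subseteq> tset ` tuples N"
    by (force simp: edges_def tuples_def image_iff)
  have "tset (x, y, z) \<in> edges N" if "rel N x y z" for x y z
    using that assms by (auto simp: edges_def R_structure_def)
  then show "tset ` tuples N \<subseteq> edges N"
    by (auto simp: tuples_def)
qed

lemma R_structure_symmetrization:
  "R_structure N \<Longrightarrow> R_structure (symmetrization N)"
  unfolding R_structure_def symmetrization_def by simp blast

lemma Rsim_structure_symmetrization:
  "R_structure N \<Longrightarrow> Rsim_structure (symmetrization N)"
  using R_structure_symmetrization[of N]
  by (auto simp: Rsim_structure_def symmetrization_def)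

lemma rel_symmetrization_iff:
  "rel (symmetrization N) x y z \<longleftrightarrow>
    rel N x y z \<or> rel N x z y \<or> rel N y x z \<or> rel N y z x \<or> rel N z x y \<or> rel N z y x"
  by (simp add: symmetrization_def)

lemma carr_symmetrization [simp]: "carr (symmetrization N) = carr N"
  by (simp add: symmetrization_def)

text \<open>
  Edges forget the order of tuples, so \<open>\<delta>\<^sub>E\<close> of the reduct can be computed in the original structure,
  where it can be compared with \<open>\<delta>\<^sub>R\<close>.
\<close>
lemma edges_symmetrization [simp]: "edges (symmetrization N) = edges N"
proof -
  have "(\<exists>a b c. S = {a, b, c} \<and> rel (symmetrization N) a b c) \<longleftrightarrow>
      (\<exists>a b c. S = {a, b, c} \<and> rel N a b c)" for S
    unfolding rel_symmetrization_iff by (metis insert_commute)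
  then show ?thesis
    by (simp add: edges_def)
qed

lemma carr_induced [simp]: "carr (induced N X) = X"
  by (simp add: induced_def)

lemma induced_induced: "X \<subseteq> Y \<Longrightarrow> induced (induced N Y) X = induced N X"
  by (auto simp: induced_def fun_eq_iff)

lemma R_structure_induced:
  "R_structure N \<Longrightarrow> R_structure (induced N X)"
  by (auto simp: R_structure_def induced_def)

lemma Rsim_structure_induced:
  "Rsim_structure N \<Longrightarrow> Rsim_structure (induced N X)"
  using R_structure_induced[of N X]
  unfolding Rsim_structure_def induced_def ternary.simps by blast

lemma strong_iff:
  "strong A N \<longleftrightarrow> finite A \<and> A \<subseteq> carr N \<and>
    (\<forall>X. finite X \<and> A \<subseteq> X \<and> X \<subseteq> carr N \<longrightarrow> \<delta>\<^sub>R N A \<le> \<delta>\<^sub>R N X)"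
  by (simp add: strong_def d0_induced)

lemma sim_strong_iff_predim:
  "sim_strong A N \<longleftrightarrow> finite A \<and> A \<subseteq> carr N \<and>
    (\<forall>X. finite X \<and> A \<subseteq> X \<and> X \<subseteq> carr N \<longrightarrow> \<delta>\<^sub>E N A \<le> \<delta>\<^sub>E N X)"
  by (simp add: sim_strong_iff d0_sim_induced)

lemma \<delta>\<^sub>R_empty [simp]: "\<delta>\<^sub>R N {} = 0"
  by (rule predim_empty) (auto simp: tuples_def)

lemma \<delta>\<^sub>E_empty [simp]: "\<delta>\<^sub>E N {} = 0"
  by (rule predim_empty) (auto simp: edges_def)

text \<open>
  Every edge that is new over \<open>A\<close> comes from some tuple that is new over \<open>A\<close>.
\<close>
lemma \<delta>\<^sub>R_diff_le_\<delta>\<^sub>E_diff: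
  assumes N: "R_structure N" and X: "finite X" and AX: "A \<subseteq> X"
  shows "\<delta>\<^sub>R N X - \<delta>\<^sub>R N A \<le> \<delta>\<^sub>E N X - \<delta>\<^sub>E N A"
proof -
  let ?T = "{t \<in> tuples N. tset t \<subseteq> X \<and> \<not> tset t \<subseteq> A}"
  have "finite {t \<in> tuples N. tset t \<subseteq> X}"
    using locally_finite_tuples[of N] X by (simp add: locally_finite_def)
  then have "finite ?T"
    by (rule rev_finite_subset) auto
  moreover have "{S \<in> edges N. S \<subseteq> X \<and> \<not> S \<subseteq> A} = tset ` ?T"
    unfolding edges_eq_tset_tuples[OF N] by auto
  ultimately have "card {S \<in> edges N. S \<subseteq> X \<and> \<not> S \<subseteq> A} \<le> card ?T"
    by (simp add: card_image_le)
  then show ?thesis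
    using predim_diff[OF locally_finite_tuples[of N] X AX]
      predim_diff[OF locally_finite_edges[of N] X AX] by linarith
qed

text \<open>
  The increments agree as soon as each new edge carries a single tuple; the tuples inside \<open>A\<close> may
  still share edges.
\<close>
lemma \<delta>\<^sub>R_diff_eq_\<delta>\<^sub>E_diff:
  assumes N: "R_structure N" and X: "finite X" and AX: "A \<subseteq> X"
    and inj: "inj_on tset {t \<in> tuples N. \<not> tset t \<subseteq> A}"
  shows "\<delta>\<^sub>R N X - \<delta>\<^sub>R N A = \<delta>\<^sub>E N X - \<delta>\<^sub>E N A"
proof -
  let ?T = "{t \<in> tuples N. tset t \<subseteq> X \<and> \<not> tset t \<subseteq> A}"
  have "inj_on tset ?T"
    using inj by (rule inj_on_subset) auto
  moreover have "{S \<in> edges N. S \<subseteq> X \<and> \<not> S \<subseteq> A} = tset ` ?T"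
    unfolding edges_eq_tset_tuples[OF N] by auto
  ultimately have "card {S \<in> edges N. S \<subseteq> X \<and> \<not> S \<subseteq> A} = card ?T"
    by (simp add: card_image)
  then show ?thesis
    using predim_diff[OF locally_finite_tuples[of N] X AX]
      predim_diff[OF locally_finite_edges[of N] X AX] by linarith
qed

lemma strong_imp_sim_strong_symmetrization:
  assumes N: "R_structure N" and A: "strong A N"
  shows "sim_strong A (symmetrization N)"
proof -
  have "\<delta>\<^sub>E N A \<le> \<delta>\<^sub>E N X" if "finite X" "A \<subseteq> X" "X \<subseteq> carr N" for X
    using \<delta>\<^sub>R_diff_le_\<delta>\<^sub>E_diff[OF N that(1,2)] A that by (fastforce simp: strong_iff)
  then show ?thesis
    using A by (simp add: strong_iff sim_strong_iff_predim)
qed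

lemma sim_strong_trans:
  assumes A: "sim_strong A (induced N B)" and B: "sim_strong B N"
  shows "sim_strong A N"
proof -
  have eq: "\<delta>\<^sub>E (induced N B) X = \<delta>\<^sub>E N X" if "X \<subseteq> B" for X
    using that by (simp flip: d0_sim_induced add: induced_induced)
  have AB: "finite A" "A \<subseteq> B"
    "\<And>X. finite X \<Longrightarrow> A \<subseteq> X \<Longrightarrow> X \<subseteq> B \<Longrightarrow> \<delta>\<^sub>E N A \<le> \<delta>\<^sub>E N X"
    using A by (simp_all add: sim_strong_iff_predim eq)
  have BN: "finite B" "B \<subseteq> carr N"
    "\<And>X. finite X \<Longrightarrow> B \<subseteq> X \<Longrightarrow> X \<subseteq> carr N \<Longrightarrow> \<delta>\<^sub>E N B \<le> \<delta>\<^sub>E N X"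
    using B by (simp_all add: sim_strong_iff_predim)
  have "\<delta>\<^sub>E N A \<le> \<delta>\<^sub>E N X" if X: "finite X" "A \<subseteq> X" "X \<subseteq> carr N" for X
  proof -
    have "\<delta>\<^sub>E N A \<le> \<delta>\<^sub>E N (X \<inter> B)"
      using AB X by (intro AB(3)) auto
    also have "\<dots> \<le> \<delta>\<^sub>E N X"
      by (rule predim_Int_le[OF locally_finite_edges BN X(1,3)])
    finally show ?thesis .
  qed
  then show ?thesis
    using AB BN by (auto simp: sim_strong_iff_predim)
qed

lemma sim_strong_induced:
  assumes "sim_strong A N" "A \<subseteq> B" "B \<subseteq> carr N"
  shows "sim_strong A (induced N B)"
  using assms by (auto simp: sim_strong_iff induced_induced)

section \<open>Transport along embeddings\<close>

lemma \<delta>\<^sub>R_embedding: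
  assumes f: "embedding f A N" and X: "X \<subseteq> carr A"
  shows "\<delta>\<^sub>R N (f ` X) = \<delta>\<^sub>R A X"
proof -
  let ?F = "\<lambda>(x, y, z). (f x, f y, f z)"
  have inj: "inj_on f X"
    using f X by (auto simp: embedding_def intro: inj_on_subset)
  have rel: "rel N (f x) (f y) (f z) \<longleftrightarrow> rel A x y z" if "x \<in> X" "y \<in> X" "z \<in> X" for x y z
    using f that[THEN subsetD[OF X]] by (simp add: embedding_def)
  have "{t \<in> tuples N. tset t \<subseteq> f ` X} = ?F ` {t \<in> tuples A. tset t \<subseteq> X}"
  proof (intro set_eqI iffI)
    fix t
    assume "t \<in> {t \<in> tuples N. tset t \<subseteq> f ` X}"
    then obtain x y z where t: "t = ?F (x, y, z)" "rel N (f x) (f y) (f z)"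
      and xyz: "x \<in> X" "y \<in> X" "z \<in> X"
      by (cases t) (auto simp: tuples_def)
    then show "t \<in> ?F ` {t \<in> tuples A. tset t \<subseteq> X}"
      by (intro image_eqI[where x = "(x, y, z)"]) (simp_all add: tuples_def rel)
  qed (auto simp: tuples_def rel)
  moreover have "inj_on ?F {t \<in> tuples A. tset t \<subseteq> X}"
    using inj by (auto simp: inj_on_def)
  ultimately show ?thesis
    by (simp add: predim_def card_image inj)
qed

lemma \<delta>\<^sub>E_embedding:
  assumes f: "embedding f A N" and X: "X \<subseteq> carr A"
  shows "\<delta>\<^sub>E N (f ` X) = \<delta>\<^sub>E A X"
proof -
  have inj: "inj_on f X"
    using f X by (auto simp: embedding_def intro: inj_on_subset)
  have rel: "rel N (f x) (f y) (f z) \<longleftrightarrow> rel A x y z" if "x \<in> X" "y \<in> X" "z \<in> X" for x y z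
    using f that[THEN subsetD[OF X]] by (simp add: embedding_def)
  have card: "card (f ` S) = card S" if "S \<subseteq> X" for S
    using inj that by (meson card_image inj_on_subset)
  have "{S \<in> edges N. S \<subseteq> f ` X} = (`) f ` {S \<in> edges A. S \<subseteq> X}"
  proof (intro set_eqI iffI)
    fix S'
    assume "S' \<in> {S \<in> edges N. S \<subseteq> f ` X}"
    then obtain a b c where S': "card S' = 3" "S' = {f a, f b, f c}" "rel N (f a) (f b) (f c)"
      and abc: "a \<in> X" "b \<in> X" "c \<in> X"
      by (force simp: edges_def)
    have "{a, b, c} \<in> edges A"
      using S' card[of "{a, b, c}"] abc rel by (auto simp: edges_def)
    then show "S' \<in> (`) f ` {S \<in> edges A. S \<subseteq> X}"
      using S' abc by (intro image_eqI[of _ _ "{a, b, c}"]) auto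
  next
    fix S'
    assume "S' \<in> (`) f ` {S \<in> edges A. S \<subseteq> X}"
    then obtain a b c where "S' = f ` {a, b, c}" "card {a, b, c} = 3" "rel A a b c"
      "{a, b, c} \<subseteq> X"
      by (auto simp: edges_def)
    then show "S' \<in> {S \<in> edges N. S \<subseteq> f ` X}"
      using rel[of a b c] card[of "{a, b, c}"] by (auto simp: edges_def)
  qed
  moreover have "inj_on ((`) f) {S \<in> edges A. S \<subseteq> X}"
    using inj_on_image_Pow[OF inj] by (rule inj_on_subset) auto
  ultimately show ?thesis
    by (simp add: predim_def card_image inj)
qed

lemma embedding_comp:
  assumes "embedding f A B" "embedding g B N"
  shows "embedding (g \<circ> f) A N"
proof -
  have "inj_on (g \<circ> f) (carr A)"
    using assms by (auto simp: embedding_def intro: comp_inj_on inj_on_subset)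
  then show ?thesis
    using assms by (auto simp: embedding_def image_subset_iff)
qed

lemma embedding_symmetrization:
  assumes "embedding f A N"
  shows "embedding f (symmetrization A) (symmetrization N)"
  using assms by (simp add: embedding_def rel_symmetrization_iff)

lemma isomorphism_strong:
  assumes f: "isomorphism f A B" and X: "strong X A"
  shows "strong (f ` X) B"
proof -
  have emb: "embedding f A B" and surj: "f ` carr A = carr B"
    using f by (auto simp: isomorphism_def)
  have "\<delta>\<^sub>R B (f ` X) \<le> \<delta>\<^sub>R B Y" if Y: "finite Y" "f ` X \<subseteq> Y" "Y \<subseteq> carr B" for Y
  proof -
    let ?Z = "{a \<in> carr A. f a \<in> Y}"
    have inj: "inj_on f ?Z"
      using emb by (auto simp: embedding_def intro: inj_on_subset)
    have img: "f ` ?Z = Y"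
      using Y(3) surj by auto
    then have "finite ?Z"
      using Y(1) inj finite_imageD by metis
    moreover have "X \<subseteq> ?Z"
      using Y(2) X by (auto simp: strong_iff)
    ultimately have "\<delta>\<^sub>R A X \<le> \<delta>\<^sub>R A ?Z"
      using X by (auto simp: strong_iff)
    then show ?thesis
      using \<delta>\<^sub>R_embedding[OF emb, of X] \<delta>\<^sub>R_embedding[OF emb, of ?Z] X img
      by (simp add: strong_iff)
  qed
  then show ?thesis
    using X surj by (auto simp: strong_iff)
qed

lemma sim_strong_embedding_image:
  assumes f: "embedding f A N" and X: "sim_strong X A"
  shows "sim_strong (f ` X) (induced N (f ` carr A))"
proof -
  have eq: "\<delta>\<^sub>E (induced N (f ` carr A)) (f ` Z) = \<delta>\<^sub>E A Z" if "Z \<subseteq> carr A" for Z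
  proof -
    have "induced (induced N (f ` carr A)) (f ` Z) = induced N (f ` Z)"
      by (rule induced_induced) (use that in auto)
    then show ?thesis
      using \<delta>\<^sub>E_embedding[OF f that] by (metis d0_sim_induced)
  qed
  have "\<delta>\<^sub>E A X \<le> \<delta>\<^sub>E (induced N (f ` carr A)) Y"
    if Y: "finite Y" "f ` X \<subseteq> Y" "Y \<subseteq> f ` carr A" for Y
  proof -
    let ?Z = "{a \<in> carr A. f a \<in> Y}"
    have inj: "inj_on f ?Z"
      using f by (auto simp: embedding_def intro: inj_on_subset)
    have img: "f ` ?Z = Y"
      using Y(3) by auto
    then have "finite ?Z"
      using Y(1) inj finite_imageD by metis
    moreover have "X \<subseteq> ?Z"
      using Y(2) X by (auto simp: sim_strong_iff_predim)
    ultimately have "\<delta>\<^sub>E A X \<le> \<delta>\<^sub>E A ?Z"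
      using X by (auto simp: sim_strong_iff_predim)
    then show ?thesis
      using eq[of ?Z] img by simp
  qed
  then show ?thesis
    using X eq[of X] by (auto simp: sim_strong_iff_predim)
qed

section \<open>Consequences of genericity\<close>

text \<open>
  The defining extension property is stated for structures on natural numbers. A finite structure on
  any type has a copy there, so the property holds for all finite structures of the class.
\<close>
lemma hrushovski_extension:
  fixes D :: "'b ternary"
  assumes M: "hrushovski_structure M" and A: "strong A M" and D: "in_C D"
    and e: "embedding e (induced M A) D" "strong (e ` A) D"
  obtains g where "embedding g D M" "strong (g ` carr D) M" "\<And>a. a \<in> A \<Longrightarrow> g (e a) = a"
proof -
  have fin: "finite (carr D)"
    using D by (simp add: in_C_def)
  obtain h :: "'b \<Rightarrow> nat" where inj: "inj_on h (carr D)"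
    using finite_imp_inj_to_nat_seg[OF fin] by blast
  define B where "B = \<lparr>carr = h ` carr D,
    rel = (\<lambda>x y z. \<exists>u v w. rel D u v w \<and> x = h u \<and> y = h v \<and> z = h w)\<rparr>"
  have RD: "R_structure D"
    using D by (simp add: in_C_def)
  have "rel D x y z \<longleftrightarrow> rel B (h x) (h y) (h z)"
    if "x \<in> carr D" "y \<in> carr D" "z \<in> carr D" for x y z
  proof
    assume "rel B (h x) (h y) (h z)"
    then obtain u v w where uvw: "rel D u v w" "h x = h u" "h y = h v" "h z = h w"
      by (auto simp: B_def)
    moreover have "u \<in> carr D" "v \<in> carr D" "w \<in> carr D"
      using uvw(1) RD by (auto simp: R_structure_def)
    ultimately show "rel D x y z"
      using inj_onD[OF inj] that by metis
  qed (auto simp: B_def)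
  then have iso: "isomorphism h D B"
    using inj by (auto simp: isomorphism_def embedding_def B_def)
  have "R_structure B"
    using RD inj by (fastforce simp: R_structure_def B_def inj_on_eq_iff)
  moreover have "strong {} B"
    using isomorphism_strong[OF iso, of "{}"] D by (simp add: in_C_def)
  ultimately have "in_C B"
    using fin by (simp add: in_C_def B_def)
  moreover have "embedding (h \<circ> e) (induced M A) B"
    using iso by (intro embedding_comp[OF e(1)]) (simp add: isomorphism_def)
  moreover have "strong ((h \<circ> e) ` A) B"
    using isomorphism_strong[OF iso e(2)] by (simp add: image_comp)
  moreover have "\<forall>A (B :: nat ternary) e.
      strong A M \<and> in_C B \<and> embedding e (induced M A) B \<and> strong (e ` A) B \<longrightarrow>
      (\<exists>g. embedding g B M \<and> strong (g ` carr B) M \<and> (\<forall>a\<in>A. g (e a) = a))"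
    using M unfolding hrushovski_structure_def by (elim conjE)
  ultimately obtain g where g: "embedding g B M" "strong (g ` carr B) M"
      "\<forall>a\<in>A. g ((h \<circ> e) a) = a"
    using A by metis
  show thesis
  proof
    show "embedding (g \<circ> h) D M"
      using iso by (intro embedding_comp[OF _ g(1)]) (simp add: isomorphism_def)
    show "strong ((g \<circ> h) ` carr D) M"
      using g(2) by (simp add: B_def image_comp)
    show "(g \<circ> h) (e a) = a" if "a \<in> A" for a
      using g(3) that by simp
  qed
qed

text \<open>
  The second bound follows from the first by comparing increments over the empty set, where both
  predimensions vanish.
\<close>
lemma hrushovski_nonneg:
  assumes M: "hrushovski_structure M" and X: "finite X" "X \<subseteq> carr M"
  shows "0 \<le> \<delta>\<^sub>R M X" "0 \<le> \<delta>\<^sub>E M X"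
proof -
  have "strong {} (induced M X)"
    using M X by (simp add: hrushovski_structure_def in_C_def)
  then have "0 \<le> d0 (induced (induced M X) X)"
    using X(1) unfolding strong_iff by (simp add: d0_induced)
  then show R: "0 \<le> \<delta>\<^sub>R M X"
    by (simp add: induced_induced d0_induced)
  have "R_structure M"
    using M by (simp add: hrushovski_structure_def)
  from \<delta>\<^sub>R_diff_le_\<delta>\<^sub>E_diff[OF this X(1), of "{}"] R show "0 \<le> \<delta>\<^sub>E M X"
    by simp
qed

lemma hrushovski_strong_closure:
  assumes M: "hrushovski_structure M" and X: "finite X" "X \<subseteq> carr M"
  obtains A where "X \<subseteq> A" "strong A M"
  using self_sufficient_closure[where \<delta> = "\<delta>\<^sub>R M", OF X hrushovski_nonneg(1)[OF M]]
  unfolding strong_iff by auto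

lemma hrushovski_sim_strong_closure:
  assumes M: "hrushovski_structure M" and X: "finite X" "X \<subseteq> carr M"
  obtains A where "X \<subseteq> A" "sim_strong A (symmetrization M)"
  using self_sufficient_closure[where \<delta> = "\<delta>\<^sub>E M", OF X hrushovski_nonneg(2)[OF M]]
  unfolding sim_strong_iff_predim edges_symmetrization carr_symmetrization by auto

lemma hrushovski_induced_in_C_sim:
  assumes M: "hrushovski_structure M" and X: "finite X" "X \<subseteq> carr M"
  shows "in_C_sim (induced (symmetrization M) X)"
proof -
  have "R_structure M"
    using M by (simp add: hrushovski_structure_def)
  then have "Rsim_structure (symmetrization M)"
    by (rule Rsim_structure_symmetrization)
  then have "Rsim_structure (induced (symmetrization M) X)"
    by (rule Rsim_structure_induced)
  moreover have "sim_strong {} (induced (symmetrization M) X)"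
    using hrushovski_nonneg(2)[OF M] X
    by (auto simp: sim_strong_iff induced_induced d0_sim_induced)
  ultimately show ?thesis
    using X by (simp add: in_C_sim_def)
qed

section \<open>The extension property of the reduct\<close>

text \<open>
  The extension property for the reduct, with \<open>\<sim>\<close>-strong in place of strong. The set \<open>B\<close> itself need
  not be strong in \<open>M\<close>, so the proof passes to a strong \<open>A \<supseteq> B\<close> and embeds an oriented free amalgam of
  \<open>A\<close> and \<open>C\<close> over \<open>B\<close> instead of \<open>C\<close> alone.
\<close>
lemma hrushovski_sim_extension:
  fixes M :: "'a ternary" and C :: "'b ternary"
  assumes M: "hrushovski_structure M" and B: "sim_strong B (symmetrization M)"
    and C: "in_C_sim C"
    and e: "embedding e (induced (symmetrization M) B) C" "sim_strong (e ` B) C"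
  obtains g where "embedding g C (symmetrization M)"
    "sim_strong (g ` carr C) (symmetrization M)" "\<And>b. b \<in> B \<Longrightarrow> g (e b) = b"
proof -
  let ?N = "symmetrization M"
  have RM: "R_structure M"
    using M by (simp add: hrushovski_structure_def)
  have RC: "R_structure C" and finC: "finite (carr C)"
    using C unfolding in_C_sim_def Rsim_structure_def by blast+
  have swap: "rel C y x z" "rel C x z y" if "rel C x y z" for x y z
    using C that unfolding in_C_sim_def Rsim_structure_def by blast+
  have permC: "rel C x y z" if "rel (symmetrization C) x y z" for x y z
    using that swap unfolding rel_symmetrization_iff by metis
  have BM: "finite B" "B \<subseteq> carr M"
    using B by (simp_all add: sim_strong_iff)
  obtain A where "B \<subseteq> A" and strongA: "strong A M"
    by (rule hrushovski_strong_closure[OF M BM])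
  then have A: "finite A" "B \<subseteq> A" "A \<subseteq> carr M"
    by (simp_all add: strong_iff)
  have inje: "inj_on e B" and eB: "e ` B \<subseteq> carr C"
    using e(1) by (simp_all add: embedding_def)
  have ce: "rel ?N x y z \<longleftrightarrow> rel C (e x) (e y) (e z)"
      if "x \<in> B" "y \<in> B" "z \<in> B" for x y z
    using e(1) that by (simp add: embedding_def induced_def)

  \<comment> \<open>A choice of one tuple on each edge of \<open>C\<close>.\<close>
  define pick where "pick S = (SOME t. t \<in> tuples C \<and> tset t = S)" for S
  have pick: "pick {x, y, z} \<in> tuples C \<and> tset (pick {x, y, z}) = {x, y, z}" if "rel C x y z" for x y z
    unfolding pick_def by (rule someI[of _ "(x, y, z)"]) (use that in \<open>simp add: tuples_def\<close>)

  \<comment> \<open>The amalgam lives on a sum type: \<open>A\<close> is included by \<open>Inl\<close>, and \<open>C\<close> by \<open>j\<close>, which identifies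
    \<open>e ` B\<close> with \<open>B \<subseteq> A\<close>.\<close>
  define j :: "'b \<Rightarrow> 'a + 'b" where "j c = (if c \<in> e ` B then Inl (inv_into B e c) else Inr c)" for c
  have je: "j (e b) = Inl b" if "b \<in> B" for b
    using that inje by (simp add: j_def)
  have injj: "inj j"
  proof (rule injI)
    fix c c'
    assume "j c = j c'"
    then show "c = c'"
      by (auto simp: j_def inje split: if_splits)
  qed
  let ?P = "Inl ` A :: ('a + 'b) set" and ?Q = "j ` carr C"
  have jP: "j c \<in> ?P \<longleftrightarrow> c \<in> e ` B" for c
    using A(2) by (auto simp: j_def inje)
  have jeB: "Inl ` B = j ` e ` B"
    by (simp add: image_image je)
  have PQ: "?P \<inter> ?Q = Inl ` B"
  proof
    show "?P \<inter> ?Q \<subseteq> Inl ` B"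
    proof
      fix u
      assume u: "u \<in> ?P \<inter> ?Q"
      then obtain c where c: "u = j c"
        by (elim IntE imageE)
      then have "c \<in> e ` B"
        using u jP[of c] by (simp only: Int_iff)
      then show "u \<in> Inl ` B"
        unfolding jeB c by (rule imageI)
    qed
    show "Inl ` B \<subseteq> ?P \<inter> ?Q"
      using image_mono[OF A(2), where f = Inl] image_mono[OF eB, where f = j]
      unfolding jeB[symmetric] by (rule Int_greatest)
  qed

  \<comment> \<open>Edges of \<open>C\<close> inside \<open>e ` B\<close> get no chosen tuple: their tuples, possibly several on one
    edge, are inherited from \<open>M\<close>.\<close>
  define D :: "('a + 'b) ternary" where "D = \<lparr>carr = ?P \<union> ?Q,
    rel = (\<lambda>u v w.
      (\<exists>x\<in>A. \<exists>y\<in>A. \<exists>z\<in>A. rel M x y z \<and> u = Inl x \<and> v = Inl y \<and> w = Inl z) \<or>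
      (\<exists>x y z. rel C x y z \<and> pick {x, y, z} = (x, y, z) \<and> \<not> {x, y, z} \<subseteq> e ` B \<and>
        u = j x \<and> v = j y \<and> w = j z))\<rparr>"
  have carrD [simp]: "carr D = ?P \<union> ?Q"
    by (simp add: D_def)
  have finD: "finite ?P" "finite ?Q"
    using A(1) finC by auto
  have relD: "rel D u v w \<longleftrightarrow>
      (\<exists>x\<in>A. \<exists>y\<in>A. \<exists>z\<in>A. rel M x y z \<and> u = Inl x \<and> v = Inl y \<and> w = Inl z) \<or>
      (\<exists>x y z. rel C x y z \<and> pick {x, y, z} = (x, y, z) \<and> \<not> {x, y, z} \<subseteq> e ` B \<and>
        u = j x \<and> v = j y \<and> w = j z)" for u v w
    by (simp add: D_def)
  have RD: "R_structure D"
  proof -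
    have "u \<in> carr D \<and> v \<in> carr D \<and> w \<in> carr D \<and> u \<noteq> v \<and> u \<noteq> w \<and> v \<noteq> w"
      if "rel D u v w" for u v w
      using that[unfolded relD]
    proof (elim disjE bexE exE conjE)
      fix x y z
      assume "x \<in> A" "y \<in> A" "z \<in> A" "rel M x y z" "u = Inl x" "v = Inl y" "w = Inl z"
      then show ?thesis
        using RM by (simp add: R_structure_def)
    next
      fix x y z
      assume "rel C x y z" "u = j x" "v = j y" "w = j z"
      then show ?thesis
        using RC by (auto simp: R_structure_def inj_eq[OF injj])
    qed
    then show ?thesis
      by (simp add: R_structure_def)
  qed

  have embA: "embedding Inl (induced M A) D"
  proof -
    have "rel D (Inl x) (Inl y) (Inl z) \<longleftrightarrow> rel M x y z" if "x \<in> A" "y \<in> A" "z \<in> A" for x y z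
    proof
      assume "rel D (Inl x) (Inl y) (Inl z)"
      then show "rel M x y z"
        unfolding relD
      proof (elim disjE bexE exE conjE)
        fix x' y' z'
        assume j: "Inl x = j x'" "Inl y = j y'" "Inl z = j z'" and not: "\<not> {x', y', z'} \<subseteq> e ` B"
        have "j x' \<in> ?P" "j y' \<in> ?P" "j z' \<in> ?P"
          using that by (simp_all flip: j)
        then show ?thesis
          using not by (simp add: jP)
      qed auto
    qed (use that in \<open>auto simp: relD\<close>)
    then show ?thesis
      by (auto simp: embedding_def induced_def)
  qed
  have embA_sim: "embedding Inl (induced ?N A) (symmetrization D)"
  proof -
    have "symmetrization (induced M A) = induced ?N A"
      by (auto simp: symmetrization_def induced_def fun_eq_iff)
    then show ?thesis
      using embedding_symmetrization[OF embA] by simp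
  qed
  have embC: "embedding j C (symmetrization D)"
  proof -
    have "rel C x y z \<longleftrightarrow> rel (symmetrization D) (j x) (j y) (j z)"
      if xyz: "x \<in> carr C" "y \<in> carr C" "z \<in> carr C" for x y z
    proof (cases "{x, y, z} \<subseteq> e ` B")
      case True
      then have "x \<in> e ` B" "y \<in> e ` B" "z \<in> e ` B"
        by simp_all
      then obtain a b c where abc: "a \<in> B" "b \<in> B" "c \<in> B" "x = e a" "y = e b" "z = e c"
        by (elim imageE) (rule that)
      have "rel ?N a b c \<longleftrightarrow> rel (symmetrization D) (Inl a) (Inl b) (Inl c)"
        using embA_sim abc(1-3) A(2) by (auto simp: embedding_def induced_def)
      then show ?thesis
        using ce abc je by simp
    next
      case False
      \<comment> \<open>Outside \<open>e ` B\<close> only the second clause of the relation of \<open>D\<close> applies.\<close>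
      have D_C: "rel D (j x) (j y) (j z) \<longleftrightarrow> rel C x y z \<and> pick {x, y, z} = (x, y, z)"
        if "\<not> {x, y, z} \<subseteq> e ` B" for x y z
      proof -
        have "\<not> {j x, j y, j z} \<subseteq> ?P"
          using that by (simp add: jP)
        then show ?thesis
          using that unfolding relD by (auto simp: inj_eq[OF injj])
      qed
      show ?thesis
      proof
        assume rel: "rel C x y z"
        obtain x' y' z' where t: "pick {x, y, z} = (x', y', z')"
          by (cases "pick {x, y, z}")
        have t': "rel C x' y' z'" "{x', y', z'} = {x, y, z}"
          using pick[OF rel] by (simp_all add: t tuples_def)
        then have "rel D (j x') (j y') (j z')"
          using D_C[of x' y' z'] False t by simp
        moreover have "x' \<noteq> y'" "x' \<noteq> z'" "y' \<noteq> z'"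
          using t'(1) RC by (auto simp: R_structure_def)
        ultimately show "rel (symmetrization D) (j x) (j y) (j z)"
          using t'(2) unfolding rel_symmetrization_iff
          by (smt (verit) insert_iff empty_iff)
      next
        assume "rel (symmetrization D) (j x) (j y) (j z)"
        then have "rel (symmetrization C) x y z"
          using False D_C unfolding rel_symmetrization_iff by (smt (verit) insert_commute)
        then show "rel C x y z"
          by (rule permC)
      qed
    qed
    then show ?thesis
      using injj by (auto simp: embedding_def intro: inj_on_subset)
  qed

  have free: "S \<subseteq> ?P \<or> S \<subseteq> ?Q" if "S \<in> edges D" for S
  proof -
    obtain u v w where S: "S = {u, v, w}" "rel D u v w"
      using \<open>S \<in> edges D\<close> unfolding edges_def by blast
    from S(2) show ?thesis
      unfolding relD
    proof (elim disjE bexE exE conjE)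
      fix x y z
      assume "rel C x y z" "u = j x" "v = j y" "w = j z"
      then show ?thesis
        using RC by (auto simp: S R_structure_def)
    qed (simp add: S)
  qed

  \<comment> \<open>The two halves of the amalgam are \<open>\<sim>\<close>-strong extensions of the common part. The half
    \<open>C\<close> makes \<open>A\<close> strong in \<open>D\<close>, the half \<open>A\<close> makes \<open>C\<close> \<open>\<sim>\<close>-strong in \<open>D\<close>.\<close>
  have sB_C: "\<delta>\<^sub>E D (Inl ` B) \<le> \<delta>\<^sub>E D Y" if Y: "Inl ` B \<subseteq> Y" "Y \<subseteq> ?Q" for Y
  proof -
    obtain Z where Z: "Z \<subseteq> carr C" "Y = j ` Z"
      using Y(2) by (auto simp: subset_image_iff)
    have "j ` e ` B \<subseteq> j ` Z"
      using Y(1) unfolding jeB Z(2) .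
    then have "e ` B \<subseteq> Z"
      by (simp only: inj_image_subset_iff[OF injj])
    moreover have "finite Z"
      by (rule finite_subset[OF Z(1) finC])
    ultimately have "\<delta>\<^sub>E C (e ` B) \<le> \<delta>\<^sub>E C Z"
      using e(2) Z(1) by (simp add: sim_strong_iff_predim)
    then show ?thesis
      using \<delta>\<^sub>E_embedding[OF embC, of "e ` B"] \<delta>\<^sub>E_embedding[OF embC, of Z] eB Z jeB by simp
  qed
  have sB_A: "\<delta>\<^sub>E D (Inl ` B) \<le> \<delta>\<^sub>E D Y" if Y: "Inl ` B \<subseteq> Y" "Y \<subseteq> ?P" for Y
  proof -
    have tr: "\<delta>\<^sub>E D (Inl ` Z) = \<delta>\<^sub>E M Z" if "Z \<subseteq> A" for Z
      using \<delta>\<^sub>E_embedding[OF embA_sim, of Z] that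
        d0_sim_induced[of "induced ?N A" Z] d0_sim_induced[of ?N Z]
      by (simp add: induced_induced)
    obtain Z where Z: "Z \<subseteq> A" "Y = Inl ` Z"
      using Y(2) by (auto simp: subset_image_iff)
    have "B \<subseteq> Z"
      using Y(1) Z(2) by auto
    moreover have "finite Z" "Z \<subseteq> carr M"
      using finite_subset[OF Z(1) A(1)] Z(1) A(3) by simp_all
    ultimately have "\<delta>\<^sub>E M B \<le> \<delta>\<^sub>E M Z"
      using B by (simp add: sim_strong_iff_predim)
    then show ?thesis
      using tr A(2) Z by simp
  qed

  have strongP: "strong ?P D"
    unfolding strong_iff
  proof (intro conjI allI impI)
    fix X
    assume "finite X \<and> ?P \<subseteq> X \<and> X \<subseteq> carr D"
    then have X: "finite X" "?P \<subseteq> X" "X \<subseteq> ?P \<union> ?Q"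
      by simp_all
    \<comment> \<open>A tuple outside \<open>A\<close> is the chosen one on its edge, hence determined by that edge.\<close>
    have "inj_on tset {t \<in> tuples D. \<not> tset t \<subseteq> ?P}"
    proof (rule inj_onI)
      fix s t
      assume s: "s \<in> {t \<in> tuples D. \<not> tset t \<subseteq> ?P}" and t: "t \<in> {t \<in> tuples D. \<not> tset t \<subseteq> ?P}"
        and st: "tset s = tset t"
      have oriented: "\<exists>x y z. t = (j x, j y, j z) \<and> pick {x, y, z} = (x, y, z)"
        if "t \<in> {t \<in> tuples D. \<not> tset t \<subseteq> ?P}" for t
        using that by (cases t) (auto simp: tuples_def relD)
      obtain x y z where xyz: "s = (j x, j y, j z)" "pick {x, y, z} = (x, y, z)"
        using oriented[OF s] by blast
      obtain x' y' z' where xyz': "t = (j x', j y', j z')" "pick {x', y', z'} = (x', y', z')"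
        using oriented[OF t] by blast
      have "j ` {x, y, z} = j ` {x', y', z'}"
        using st xyz(1) xyz'(1) by simp
      then have "{x, y, z} = {x', y', z'}"
        by (simp only: inj_image_eq_iff[OF injj])
      then have "pick {x, y, z} = pick {x', y', z'}"
        by (rule arg_cong)
      then have "(x, y, z) = (x', y', z')"
        by (simp only: xyz(2) xyz'(2))
      then show "s = t"
        unfolding xyz(1) xyz'(1) by simp
    qed
    from \<delta>\<^sub>R_diff_eq_\<delta>\<^sub>E_diff[OF RD X(1,2) this]
    have "\<delta>\<^sub>R D X - \<delta>\<^sub>R D ?P = \<delta>\<^sub>E D X - \<delta>\<^sub>E D ?P" .
    moreover have "\<delta>\<^sub>E D ?P \<le> \<delta>\<^sub>E D X"
      by (rule free_amalgam_self_sufficient[OF locally_finite_edges finD free _ X(2,3)])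
        (simp_all only: PQ sB_C)
    ultimately show "\<delta>\<^sub>R D ?P \<le> \<delta>\<^sub>R D X"
      by linarith
  qed (use finD in auto)

  \<comment> \<open>Membership of \<open>D\<close> in the class reduces to subsets of \<open>A\<close>, where \<open>\<delta>\<^sub>R\<close> is computed in \<open>M\<close>.\<close>
  have "strong {} D"
    unfolding strong_iff
  proof (intro conjI allI impI)
    fix X
    assume "finite X \<and> {} \<subseteq> X \<and> X \<subseteq> carr D"
    then have X: "finite X" "X \<subseteq> carr D"
      by auto
    obtain Z where Z: "Z \<subseteq> A" "X \<inter> ?P = Inl ` Z"
      using subset_imageE[of "X \<inter> ?P" Inl A] by blast
    have "\<delta>\<^sub>R D (Inl ` Z) = \<delta>\<^sub>R M Z"
      using \<delta>\<^sub>R_embedding[OF embA, of Z] Z(1)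
        d0_induced[of "induced M A" Z] d0_induced[of M Z]
      by (simp add: induced_induced)
    moreover have "0 \<le> \<delta>\<^sub>R M Z"
      using finite_subset[OF Z(1) A(1)] Z(1) A(3) by (intro hrushovski_nonneg(1)[OF M]) simp_all
    moreover have "\<delta>\<^sub>R D (X \<inter> ?P) \<le> \<delta>\<^sub>R D X"
      using strongP finD(1) by (intro predim_Int_le[OF locally_finite_tuples _ _ _ X])
        (simp_all add: strong_iff)
    ultimately show "\<delta>\<^sub>R D {} \<le> \<delta>\<^sub>R D X"
      using Z(2) by simp
  qed auto
  then have "in_C D"
    using RD finD by (simp add: in_C_def)
  from hrushovski_extension[OF M strongA this embA strongP]
  obtain g where g: "embedding g D M" "strong (g ` carr D) M" "\<And>a. a \<in> A \<Longrightarrow> g (Inl a) = a"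
    by blast
  have gsim: "embedding g (symmetrization D) ?N"
    by (rule embedding_symmetrization[OF g(1)])

  have strongQ: "sim_strong ?Q (symmetrization D)"
    unfolding sim_strong_iff_predim
  proof (intro conjI allI impI)
    fix X
    assume "finite X \<and> ?Q \<subseteq> X \<and> X \<subseteq> carr (symmetrization D)"
    then have X: "?Q \<subseteq> X" "X \<subseteq> ?P \<union> ?Q"
      by simp_all
    have QP: "?Q \<inter> ?P = Inl ` B"
      using PQ by (simp only: Int_commute)
    have "X \<subseteq> ?Q \<union> ?P"
      using X(2) by (simp only: Un_commute)
    moreover have "S \<subseteq> ?Q \<or> S \<subseteq> ?P" if "S \<in> edges D" for S
      using free[OF that] by (simp only: disj_commute)
    ultimately have "\<delta>\<^sub>E D ?Q \<le> \<delta>\<^sub>E D X"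
      using free_amalgam_self_sufficient[OF locally_finite_edges finD(2,1), of D X] sB_A X(1)
      unfolding QP by simp
    then show "\<delta>\<^sub>E (symmetrization D) ?Q \<le> \<delta>\<^sub>E (symmetrization D) X"
      by simp
  qed (use finD in auto)
  show thesis
  proof
    show "embedding (g \<circ> j) C ?N"
      by (rule embedding_comp[OF embC gsim])
    have "sim_strong (g ` ?Q) (induced ?N (g ` carr D))"
      using sim_strong_embedding_image[OF gsim strongQ] by simp
    then have "sim_strong (g ` ?Q) ?N"
      using strong_imp_sim_strong_symmetrization[OF RM g(2)] by (rule sim_strong_trans)
    then show "sim_strong ((g \<circ> j) ` carr C) ?N"
      by (simp add: image_comp)
    show "(g \<circ> j) (e b) = b" if "b \<in> B" for b
      using that g(3) je A(2) by auto
  qed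
qed

section \<open>Homogeneity\<close>

lemma back_and_forth:
  fixes P :: "('a \<times> 'a) set \<Rightarrow> bool"
  assumes S: "countable S" and F0: "P F0"
    and extend_domain: "\<And>F x. P F \<Longrightarrow> x \<in> S \<Longrightarrow> \<exists>F'. P F' \<and> F \<subseteq> F' \<and> x \<in> Domain F'"
    and extend_range: "\<And>F x. P F \<Longrightarrow> x \<in> S \<Longrightarrow> \<exists>F'. P F' \<and> F \<subseteq> F' \<and> x \<in> Range F'"
  obtains G :: "nat \<Rightarrow> ('a \<times> 'a) set" where "incseq G" "\<And>n. P (G n)" "G 0 = F0"
    "S \<subseteq> Domain (\<Union>n. G n)" "S \<subseteq> Range (\<Union>n. G n)"
proof -
  let ?x = "from_nat_into S"
  \<comment> \<open>The guard \<open>?x n \<in> S\<close> matters for empty \<open>S\<close>, where \<open>from_nat_into\<close> returns an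
    arbitrary element.\<close>
  let ?Q = "\<lambda>n F F'. F \<subseteq> F' \<and> (?x n \<in> S \<longrightarrow> ?x n \<in> Domain F' \<and> ?x n \<in> Range F')"
  have step: "\<exists>F'. P F' \<and> ?Q n F F'" if F: "P F" for F n
  proof (cases "?x n \<in> S")
    case True
    obtain F1 where F1: "P F1" "F \<subseteq> F1" "?x n \<in> Domain F1"
      using extend_domain[OF F True] by blast
    obtain F2 where F2: "P F2" "F1 \<subseteq> F2" "?x n \<in> Range F2"
      using extend_range[OF F1(1) True] by blast
    have "?x n \<in> Domain F2"
      using F1(3) F2(2) by blast
    then show ?thesis
      using F1(2) F2 by (intro exI[of _ F2]) simp
  qed (use F in blast)
  have "\<exists>G. \<forall>n. (P (G n) \<and> (n = 0 \<longrightarrow> G n = F0)) \<and> ?Q n (G n) (G (Suc n))"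
  proof (rule dependent_nat_choice)
    show "\<exists>F. P F \<and> (0 = (0::nat) \<longrightarrow> F = F0)"
      using F0 by blast
    show "\<exists>F'. (P F' \<and> (Suc n = 0 \<longrightarrow> F' = F0)) \<and> ?Q n F F'"
      if "P F \<and> (n = 0 \<longrightarrow> F = F0)" for F n
      using step[of F n] that by simp
  qed
  then obtain G where "\<forall>n. (P (G n) \<and> (n = 0 \<longrightarrow> G n = F0)) \<and> ?Q n (G n) (G (Suc n))" ..
  then have G: "\<And>n. P (G n)" "\<And>n. ?Q n (G n) (G (Suc n))" "G 0 = F0"
    by blast+
  show thesis
  proof
    show "incseq G"
      using G(2) by (intro incseq_SucI) blast
    have "s \<in> Domain (\<Union>n. G n) \<and> s \<in> Range (\<Union>n. G n)" if "s \<in> S" for s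
    proof -
      obtain n where "?x n = s"
        using from_nat_into_surj[OF S \<open>s \<in> S\<close>] by blast
      then have "s \<in> Domain (G (Suc n))" "s \<in> Range (G (Suc n))"
        using G(2)[of n] that by auto
      then show ?thesis
        by blast
    qed
    then show "S \<subseteq> Domain (\<Union>n. G n)" "S \<subseteq> Range (\<Union>n. G n)"
      by blast+
  qed (use G in auto)
qed

text \<open>
  Partial isomorphisms are encoded as graphs rather than functions, so that chains have unions and the
  converse step of back-and-forth is literally the converse relation.
\<close>
definition partial_iso :: "'a ternary \<Rightarrow> ('a \<times> 'a) set \<Rightarrow> bool" where
  "partial_iso N F \<longleftrightarrow> single_valued F \<and> single_valued (F\<inverse>) \<and>
    (\<forall>(a, a')\<in>F. \<forall>(b, b')\<in>F. \<forall>(c, c')\<in>F. rel N a b c \<longleftrightarrow> rel N a' b' c')"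

lemma partial_iso_converse: "partial_iso N F \<Longrightarrow> partial_iso N (F\<inverse>)"
  by (fastforce simp: partial_iso_def)

lemma partial_iso_graph_embedding:
  assumes f: "embedding f (induced N A) N"
  shows "partial_iso N {(a, f a) | a. a \<in> A}"
proof -
  have "inj_on f A" and "\<And>a b c. a \<in> A \<Longrightarrow> b \<in> A \<Longrightarrow> c \<in> A \<Longrightarrow> rel N a b c \<longleftrightarrow> rel N (f a) (f b) (f c)"
    using f by (auto simp: embedding_def induced_def)
  then show ?thesis
    by (auto simp: partial_iso_def single_valued_def inj_on_def)
qed

lemma partial_iso_obtain_embedding:
  assumes F: "partial_iso N F" and ran: "Range F \<subseteq> carr N"
  obtains f where "embedding f (induced N (Domain F)) N" "F = {(a, f a) | a. a \<in> Domain F}"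
    "f ` Domain F = Range F"
proof -
  define f where "f a = (SOME b. (a, b) \<in> F)" for a
  have f: "(a, f a) \<in> F" if "a \<in> Domain F" for a
    unfolding f_def by (rule someI_ex) (use that in blast)
  have sv: "b = f a" if "(a, b) \<in> F" for a b
    using F that f[of a] by (auto simp: partial_iso_def single_valued_def)
  have "inj_on f (Domain F)"
  proof (rule inj_onI)
    fix a a'
    assume "a \<in> Domain F" "a' \<in> Domain F" "f a = f a'"
    then have "(f a, a) \<in> F\<inverse>" "(f a, a') \<in> F\<inverse>"
      using f[of a] f[of a'] by simp_all
    then show "a = a'"
      using F unfolding partial_iso_def by (meson single_valuedD)
  qed
  moreover have "rel N a b c \<longleftrightarrow> rel N (f a) (f b) (f c)"
    if "a \<in> Domain F" "b \<in> Domain F" "c \<in> Domain F" for a b c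
    using F f[OF that(1)] f[OF that(2)] f[OF that(3)] unfolding partial_iso_def by fast
  moreover have "f ` Domain F \<subseteq> carr N"
    using f ran by blast
  ultimately have "embedding f (induced N (Domain F)) N"
    by (auto simp: embedding_def induced_def)
  moreover have "F = {(a, f a) | a. a \<in> Domain F}"
    using f sv by auto
  moreover have "f ` Domain F = Range F"
    using f sv by blast
  ultimately show thesis
    by (rule that)
qed

lemma partial_iso_Union_chain:
  fixes G :: "nat \<Rightarrow> ('a \<times> 'a) set"
  assumes inc: "incseq G" and G: "\<And>n. partial_iso N (G n)"
  shows "partial_iso N (\<Union>n. G n)"
proof -
  have common: "\<exists>n. p \<in> G n \<and> q \<in> G n \<and> r \<in> G n"
    if pqr: "p \<in> (\<Union>n. G n)" "q \<in> (\<Union>n. G n)" "r \<in> (\<Union>n. G n)" for p q r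
  proof -
    obtain k l m where "p \<in> G k" "q \<in> G l" "r \<in> G m"
      using pqr by blast
    moreover have "G k \<subseteq> G (k + l + m)" "G l \<subseteq> G (k + l + m)" "G m \<subseteq> G (k + l + m)"
      by (intro monoD[OF inc]; simp)+
    ultimately show ?thesis
      by blast
  qed
  show ?thesis
    unfolding partial_iso_def
  proof (intro conjI)
    show "single_valued (\<Union>n. G n)"
    proof (rule single_valuedI)
      fix a b b'
      assume "(a, b) \<in> (\<Union>n. G n)" "(a, b') \<in> (\<Union>n. G n)"
      from common[OF this this(1)] show "b = b'"
        using G by (auto simp: partial_iso_def single_valued_def)
    qed
    show "single_valued ((\<Union>n. G n)\<inverse>)"
    proof (rule single_valuedI, unfold converse_iff)
      fix b a a'
      assume "(a, b) \<in> (\<Union>n. G n)" "(a', b) \<in> (\<Union>n. G n)"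
      from common[OF this this(1)] show "a = a'"
        using G by (auto simp: partial_iso_def single_valued_def)
    qed
    have "rel N (fst p) (fst q) (fst r) \<longleftrightarrow> rel N (snd p) (snd q) (snd r)"
      if "p \<in> (\<Union>n. G n)" "q \<in> (\<Union>n. G n)" "r \<in> (\<Union>n. G n)" for p q r
      using common[OF that] G unfolding partial_iso_def split_beta by blast
    then show "\<forall>(a, a')\<in>(\<Union>n. G n). \<forall>(b, b')\<in>(\<Union>n. G n). \<forall>(c, c')\<in>(\<Union>n. G n).
        rel N a b c \<longleftrightarrow> rel N a' b' c'"
      unfolding split_beta by (intro ballI)
  qed
qed

definition sim_partial_iso :: "'a ternary \<Rightarrow> ('a \<times> 'a) set \<Rightarrow> bool" where
  "sim_partial_iso N F \<longleftrightarrow>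
    partial_iso N F \<and> sim_strong (Domain F) N \<and> sim_strong (Range F) N"

text \<open>
  Enlarge the domain to a \<open>\<sim>\<close>-strong set \<open>A\<close> containing \<open>x\<close> and regard it as an abstract extension
  of the range via the inverse of the partial isomorphism. The extension property realizes it over
  the range.
\<close>
lemma sim_partial_iso_forth:
  assumes M: "hrushovski_structure M" and F: "sim_partial_iso (symmetrization M) F"
    and x: "x \<in> carr M"
  shows "\<exists>F'. sim_partial_iso (symmetrization M) F' \<and> F \<subseteq> F' \<and> x \<in> Domain F'"
proof -
  let ?N = "symmetrization M"
  have dom: "sim_strong (Domain F) ?N" and ran: "sim_strong (Range F) ?N"
    and iso: "partial_iso ?N F"
    using F by (auto simp: sim_partial_iso_def)
  have Fx: "finite (insert x (Domain F))" "insert x (Domain F) \<subseteq> carr M"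
    using dom x by (auto simp: sim_strong_iff)
  obtain A where "insert x (Domain F) \<subseteq> A" and strongA: "sim_strong A ?N"
    by (rule hrushovski_sim_strong_closure[OF M Fx])
  then have A: "finite A" "insert x (Domain F) \<subseteq> A" "A \<subseteq> carr M"
    by (simp_all add: sim_strong_iff)
  have "Range (F\<inverse>) \<subseteq> carr ?N"
    using dom by (simp add: sim_strong_iff)
  from partial_iso_obtain_embedding[OF partial_iso_converse[OF iso] this,
      unfolded Domain_converse Range_converse]
  obtain e where e: "embedding e (induced ?N (Range F)) ?N"
      "F\<inverse> = {(b, e b) | b. b \<in> Range F}" "e ` Range F = Domain F"
    by blast
  have "embedding e (induced ?N (Range F)) (induced ?N A)"
  proof -
    have "e b \<in> A" if "b \<in> Range F" for b
      using that e(3) A(2) by blast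
    then show ?thesis
      using e(1) by (auto simp: embedding_def induced_def)
  qed
  moreover have "sim_strong (e ` Range F) (induced ?N A)"
    using A e(3) by (auto intro!: sim_strong_induced[OF dom])
  ultimately obtain g where g: "embedding g (induced ?N A) ?N"
      "sim_strong (g ` carr (induced ?N A)) ?N" "\<And>b. b \<in> Range F \<Longrightarrow> g (e b) = b"
    using hrushovski_sim_extension[OF M ran hrushovski_induced_in_C_sim[OF M A(1,3)]] by blast
  let ?F' = "{(a, g a) | a. a \<in> A}"
  have "Domain ?F' = A" "Range ?F' = g ` A"
    by auto
  then have "sim_partial_iso ?N ?F'"
    using partial_iso_graph_embedding[OF g(1)] strongA g(2) by (simp add: sim_partial_iso_def)
  moreover have "F \<subseteq> ?F'"
  proof
    fix p
    assume "p \<in> F"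
    then obtain a b where p: "p = (a, b)" "(b, a) \<in> F\<inverse>" "b \<in> Range F" "a \<in> Domain F"
      by (cases p) auto
    then have "a = e b"
      using e(2) by auto
    then show "p \<in> ?F'"
      using p g(3) A(2) by auto
  qed
  ultimately show ?thesis
    using A(2) \<open>Domain ?F' = A\<close> by blast
qed

lemma sim_partial_iso_back:
  assumes M: "hrushovski_structure M" and F: "sim_partial_iso (symmetrization M) F"
    and x: "x \<in> carr M"
  shows "\<exists>F'. sim_partial_iso (symmetrization M) F' \<and> F \<subseteq> F' \<and> x \<in> Range F'"
proof -
  have conv: "sim_partial_iso (symmetrization M) (F\<inverse>)"
    if "sim_partial_iso (symmetrization M) F" for F
    using that partial_iso_converse by (auto simp: sim_partial_iso_def)
  obtain F' where "sim_partial_iso (symmetrization M) F'" "F\<inverse> \<subseteq> F'" "x \<in> Domain F'"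
    using sim_partial_iso_forth[OF M conv[OF F] x] by blast
  then show ?thesis
    using conv by (intro exI[of _ "F'\<inverse>"]) auto
qed

lemma hrushovski_sim_homogeneous:
  assumes M: "hrushovski_structure M"
    and A: "sim_strong A (symmetrization M)" and B: "sim_strong B (symmetrization M)"
    and f: "isomorphism f (induced (symmetrization M) A) (induced (symmetrization M) B)"
  shows "\<exists>g. isomorphism g (symmetrization M) (symmetrization M) \<and> (\<forall>a\<in>A. g a = f a)"
proof -
  let ?N = "symmetrization M" and ?F = "{(a, f a) | a. a \<in> A}"
  have img: "f ` A = B"
    using f by (simp add: isomorphism_def)
  have "f a \<in> B" if "a \<in> A" for a
    using img that by blast
  then have "embedding f (induced ?N A) ?N"
    using f B by (auto simp: isomorphism_def embedding_def induced_def sim_strong_iff)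
  then have "partial_iso ?N ?F"
    by (rule partial_iso_graph_embedding)
  moreover have "Domain ?F = A" "Range ?F = B"
    using img by auto
  ultimately have F: "sim_partial_iso ?N ?F"
    using A B by (simp add: sim_partial_iso_def)
  have "countable (carr M)"
    using M by (simp add: hrushovski_structure_def)
  from back_and_forth[OF this, of "sim_partial_iso ?N", OF F
      sim_partial_iso_forth[OF M] sim_partial_iso_back[OF M]]
  obtain G where G: "incseq G" "\<And>n. sim_partial_iso ?N (G n)" "G 0 = ?F"
      "carr M \<subseteq> Domain (\<Union>n. G n)" "carr M \<subseteq> Range (\<Union>n. G n)"
    by blast
  let ?G = "\<Union>n. G n"
  have "Domain (G n) \<subseteq> carr M" "Range (G n) \<subseteq> carr M" for n
    using G(2)[of n] by (auto simp: sim_partial_iso_def sim_strong_iff)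
  then have dom: "Domain ?G = carr M" and ran: "Range ?G = carr M"
    using G(4,5) by blast+
  have isoG: "partial_iso ?N ?G"
    using G(1,2) by (intro partial_iso_Union_chain) (auto simp: sim_partial_iso_def)
  have "Range ?G \<subseteq> carr ?N"
    using ran by simp
  from partial_iso_obtain_embedding[OF isoG this, unfolded dom ran]
  obtain g where g: "embedding g (induced ?N (carr M)) ?N" "?G = {(a, g a) | a. a \<in> carr M}"
      "g ` carr M = carr M"
    by blast
  have "isomorphism g ?N ?N"
    using g(1,3) by (auto simp: isomorphism_def embedding_def induced_def)
  moreover have "g a = f a" if "a \<in> A" for a
  proof -
    have "(a, f a) \<in> ?G"
      using that G(3) by blast
    then show ?thesis
      unfolding g(2) by simp
  qed
  ultimately show ?thesis
    by blast
qed

lemma hrushovski_sim_universal: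
  assumes M: "hrushovski_structure M" and B: "in_C_sim B"
  obtains f where "sim_strong_embedding f B (symmetrization M)"
proof -
  have "sim_strong {} (symmetrization M)"
    using hrushovski_nonneg(2)[OF M] by (auto simp: sim_strong_iff_predim)
  moreover have "embedding f (induced (symmetrization M) {}) B" for f
    by (simp add: embedding_def)
  moreover have "sim_strong (f ` {}) B" for f :: "'a \<Rightarrow> 'b"
    using B by (simp add: in_C_sim_def)
  ultimately show thesis
    using hrushovski_sim_extension[OF M _ B] that unfolding sim_strong_embedding_def by metis
qed

theorem theorem8p14:
  fixes M :: "'a ternary"
  assumes "hrushovski_structure M"
  shows "fraisse_limit_C_sim (symmetrization M)"
  unfolding fraisse_limit_C_sim_def
proof (intro conjI allI impI)
  show "Rsim_structure (symmetrization M)"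
    using assms by (intro Rsim_structure_symmetrization) (simp add: hrushovski_structure_def)
  show "countable (carr (symmetrization M))"
    using assms by (simp add: hrushovski_structure_def)
  show "in_C_sim (induced (symmetrization M) A)"
    if "finite A \<and> A \<subseteq> carr (symmetrization M)" for A
    using hrushovski_induced_in_C_sim[OF assms] that by simp
  show "\<exists>f. sim_strong_embedding f B (symmetrization M)"
    if "in_C_sim B" for B :: "nat ternary"
    using hrushovski_sim_universal[OF assms that] by blast
  show "\<exists>A f. finite A \<and> A \<subseteq> carr (symmetrization M) \<and>
      isomorphism f B (induced (symmetrization M) A)"
    if "in_C_sim B" for B :: "nat ternary"
  proof -
    obtain f where f: "embedding f B (symmetrization M)"
      "sim_strong (f ` carr B) (symmetrization M)"
      using hrushovski_sim_universal[OF assms \<open>in_C_sim B\<close>]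
      unfolding sim_strong_embedding_def by blast
    have "isomorphism f B (induced (symmetrization M) (f ` carr B))"
      using f(1) by (auto simp: isomorphism_def embedding_def induced_def)
    then show ?thesis
      using f(2) unfolding sim_strong_iff by blast
  qed
  show "\<exists>g. isomorphism g (symmetrization M) (symmetrization M) \<and> (\<forall>a\<in>A. g a = f a)"
    if "sim_strong A (symmetrization M) \<and> sim_strong B (symmetrization M) \<and>
      isomorphism f (induced (symmetrization M) A) (induced (symmetrization M) B)" for A B f
    using hrushovski_sim_homogeneous[OF assms] that by blast
qed

end
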